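(* Let $F$ be a finitely generated free group, let $H$ be a finitely generated subgroup of $F$, let $p$ be a prime number, and let $N_{p-1}=[F,F]F^{p-1}$. Then the following are equivalent: (1) $H$ is $\mathbf{H}_p$-dense in $F$; (2) $H$ is $\mathbf{Ab}_p*\mathbf{Ab}_{p-1}$-dense in $F$; (3) $H\cdot [N_{p-1},N_{p-1}]N_{p-1}^{p}=F$; (4) $H$ is $\mathbf{Ab}_{p-1}$-dense in $F$ and $H\cap N_{p-1}$ is $\mathbf{Ab}_p$-dense in $N_{p-1}$.
   Context: A variety is a class of finite groups closed under taking subgroups, homomorphic images and (finite) direct products. The product $\mathbf{U}*\mathbf{V}$ of two varieties consists of all finite groups $G$ having a normal subgroup $N\in\mathbf{U}$ with $G/N\in\mathbf{V}$. For a prime $p$, $\mathbf{G}_p$ is the variety of all finite $p$-groups; for a positive integer $d$, $\mathbf{Ab}_d$ is the variety of all finite abelian groups of exponent dividing $d$; and $\mathbf{H}_p=\mathbf{G}_p*\mathbf{Ab}_{p-1}$. For a variety $\mathbf{V}$, the pro-$\mathbf{V}$ topology on a group $G$ is the topology having as a basis of open sets all cosets $Kx$, where $x\in G$ and $K$ ranges over the normal subgroups of $G$ with $G/K\in\mathbf{V}$. A subset $S\subseteq G$ is $\mathbf{V}$-dense in $G$ if its closure in the pro-$\mathbf{V}$ topology of $G$ is $G$. In (4), $N_{p-1}$ (itself a free group) carries its own pro-$\mathbf{Ab}_p$ topology. For a group $G$ and a positive integer $m$, $[G,G]$ is the derived subgroup and $G^m$ is the subgroup generated by all $m$-th powers of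 elements of $G$. *)

theory Defs
  imports "HOL-Algebra.Generated_Groups" "HOL-Analysis.Abstract_Topology" "HOL-Computational_Algebra.Primes"
begin

section \<open>Free groups\<close>

text \<open>A word over \<open>X\<close> is a list of letters \<open>(x, e)\<close> with \<open>x \<in> X\<close>, where \<open>(x, True)\<close> stands for \<open>x\<close>
  and \<open>(x, False)\<close> for the inverse of \<open>x\<close>.\<close>

definition word_value :: "('a, 'b) monoid_scheme \<Rightarrow> ('a \<times> bool) list \<Rightarrow> 'a" where
  "word_value G w = foldr (\<lambda>(x, e) y. (if e then x else inv\<^bsub>G\<^esub> x) \<otimes>\<^bsub>G\<^esub> y) w \<one>\<^bsub>G\<^esub>"

definition reduced_words :: "'a set \<Rightarrow> ('a \<times> bool) list set" where
  "reduced_words X = {w. fst ` set w \<subseteq> X \<and>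
     successively (\<lambda>a b. \<not> (fst a = fst b \<and> snd a \<noteq> snd b)) w}"

definition free_basis :: "('a, 'b) monoid_scheme \<Rightarrow> 'a set \<Rightarrow> bool" where
  "free_basis G X \<longleftrightarrow> X \<subseteq> carrier G \<and> bij_betw (word_value G) (reduced_words X) (carrier G)"

definition free_group :: "('a, 'b) monoid_scheme \<Rightarrow> bool" where
  "free_group G \<longleftrightarrow> group G \<and> (\<exists>X. free_basis G X)"

definition fin_gen_subgroup :: "'a set \<Rightarrow> ('a, 'b) monoid_scheme \<Rightarrow> bool" where
  "fin_gen_subgroup H G \<longleftrightarrow> subgroup H G \<and> (\<exists>S. finite S \<and> S \<subseteq> carrier G \<and> generate G S = H)"

section \<open>Classes of finite groups\<close>

text \<open>A class of groups is a predicate on groups. The predicates below are polymorphic in the type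
  of the elements, so that they can be applied to a group, to its subgroups and to its quotients,
  which are groups of cosets.\<close>

definition p_groups :: "nat \<Rightarrow> ('a, 'b) monoid_scheme \<Rightarrow> bool" where
  "p_groups p G \<longleftrightarrow> group G \<and> finite (carrier G) \<and> (\<exists>n. order G = p ^ n)"

definition Ab :: "nat \<Rightarrow> ('a, 'b) monoid_scheme \<Rightarrow> bool" where
  "Ab d G \<longleftrightarrow> comm_group G \<and> finite (carrier G) \<and> (\<forall>x\<in>carrier G. x [^]\<^bsub>G\<^esub> d = \<one>\<^bsub>G\<^esub>)"

definition class_prod ::
  "(('a, 'b) monoid_scheme \<Rightarrow> bool) \<Rightarrow> ('a set monoid \<Rightarrow> bool) \<Rightarrow> ('a, 'b) monoid_scheme \<Rightarrow> bool"
  where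
  "class_prod U V G \<longleftrightarrow> group G \<and> finite (carrier G) \<and>
     (\<exists>N. N \<lhd> G \<and> U (G\<lparr>carrier := N\<rparr>) \<and> V (G Mod N))"

definition H_groups :: "nat \<Rightarrow> ('a, 'b) monoid_scheme \<Rightarrow> bool" where
  "H_groups p = class_prod (p_groups p) (Ab (p - 1))"

section \<open>Pro-V topologies\<close>

text \<open>When \<open>V\<close> is a variety of finite groups, the intersection of two of the cosets below is empty
  or again such a coset, so that they do form a basis of a topology on \<open>carrier G\<close>.\<close>

definition pro_topology :: "('a set monoid \<Rightarrow> bool) \<Rightarrow> ('a, 'b) monoid_scheme \<Rightarrow> 'a topology" where
  "pro_topology V G = topology (arbitrary union_of
     (\<lambda>B. \<exists>K x. K \<lhd> G \<and> V (G Mod K) \<and> x \<in> carrier G \<and> B = K #>\<^bsub>G\<^esub> x))"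

definition pro_dense :: "('a set monoid \<Rightarrow> bool) \<Rightarrow> ('a, 'b) monoid_scheme \<Rightarrow> 'a set \<Rightarrow> bool" where
  "pro_dense V G S \<longleftrightarrow> S \<subseteq> carrier G \<and> (pro_topology V G) closure_of S = carrier G"

section \<open>Derived subgroups and powers\<close>

text \<open>\<open>power_subgroup G M m\<close> is \<open>M\<^sup>m\<close> and \<open>derived_power G M m\<close> is \<open>[M, M] M\<^sup>m\<close>, for a
  subgroup \<open>M\<close> of \<open>G\<close>.\<close>

definition power_subgroup :: "('a, 'b) monoid_scheme \<Rightarrow> 'a set \<Rightarrow> nat \<Rightarrow> 'a set" where
  "power_subgroup G M m = generate G ((\<lambda>x. x [^]\<^bsub>G\<^esub> m) ` M)"

definition derived_power :: "('a, 'b) monoid_scheme \<Rightarrow> 'a set \<Rightarrow> nat \<Rightarrow> 'a set" where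
  "derived_power G M m = derived G M <#>\<^bsub>G\<^esub> power_subgroup G M m"

end

theory Submission
  imports Defs "HOL-Algebra.SndIsomorphismGrp" "HOL-Algebra.Multiplicative_Group" "HOL-Algebra.Sylow"
    "HOL-Algebra.Group_Action"
begin

text \<open>Density in each of the topologies is decided by how a subgroup multiplies with normal subgroups of
  finite index: \<open>H\<close> is dense in the pro-\<open>V\<close> topology of \<open>F\<close> iff \<open>H K = F\<close> for each normal subgroup \<open>K\<close> with
  \<open>F/K\<close> in \<open>V\<close> (\<open>pro_dense_iff\<close>). Put \<open>N = [F, F] F\<^bsup>p-1\<^esup>\<close> and \<open>M = [N, N] N\<^sup>p\<close>. For a normal subgroup \<open>K\<close>
  of finite index, \<open>F/K\<close> is in \<open>Ab\<^bsub>p-1\<^esub>\<close> iff \<open>N \<subseteq> K\<close>; it is in \<open>Ab\<^sub>p * Ab\<^bsub>p-1\<^esub>\<close> iff \<open>M \<subseteq> K\<close>; and it is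
  in \<open>H\<^sub>p\<close> iff each element of \<open>N\<close> has a \<open>p\<close>-power in \<open>K\<close>. Both \<open>N\<close> and \<open>M\<close> have finite index: \<open>F/N\<close> and
  \<open>N/M\<close> are abelian of finite exponent, and they are finitely generated, the second one by Schreier's lemma
  (\<open>fin_gen_subgroup_finite_index\<close>).

  Hence \<open>H\<close> is dense for \<open>Ab\<^sub>p * Ab\<^bsub>p-1\<^esub>\<close> iff \<open>H M = F\<close>, dense for \<open>Ab\<^bsub>p-1\<^esub>\<close> iff \<open>H N = F\<close>, and \<open>H \<inter> N\<close> is dense
  in \<open>N\<close> for \<open>Ab\<^sub>p\<close> iff \<open>(H \<inter> N) M = N\<close>. By the modular law the first equality is equivalent to the
  conjunction of the other two.

  There remains \<open>H\<^sub>p\<close>. As \<open>M\<close> contains the \<open>p\<close>-th powers of elements of \<open>N\<close>, density for \<open>H\<^sub>p\<close> gives \<open>H M = F\<close>.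
  Conversely let \<open>H M = F\<close> and let \<open>F/K\<close> be in \<open>H\<^sub>p\<close>. The image of \<open>N\<close> in \<open>F/K\<close> is a finite \<open>p\<close>-group \<open>P\<close>, and
  the image \<open>A\<close> of \<open>H \<inter> N\<close> satisfies \<open>A [P, P] P\<^sup>p = P\<close>. In a finite \<open>p\<close>-group every maximal subgroup is normal
  of index \<open>p\<close> and so contains \<open>[P, P] P\<^sup>p\<close>; therefore \<open>A = P\<close> (\<open>p_group_nongenerators\<close>). This gives
  \<open>N \<subseteq> H K\<close>, and with \<open>H N = F\<close> it gives \<open>H K = F\<close>.\<close>

section \<open>The subgroups \<open>[M, M] M\<^sup>d\<close>\<close>

lemma (in group) subgroup_nat_pow_closed:
  assumes "subgroup K G" "x \<in> K"
  shows "x [^] (n::nat) \<in> K"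
proof -
  interpret K: subgroup K G by fact
  show ?thesis using assms(2) by (induction n) auto
qed

lemma (in group) power_subgroup_incl:
  assumes "subgroup K G" "\<And>x. x \<in> M \<Longrightarrow> x [^] (d::nat) \<in> K"
  shows "power_subgroup G M d \<subseteq> K"
  unfolding power_subgroup_def using assms by (intro generate_subgroup_incl) auto

lemma (in group) power_subgroup_is_subgroup:
  assumes "M \<subseteq> carrier G"
  shows "subgroup (power_subgroup G M d) G"
  unfolding power_subgroup_def using assms by (intro generate_is_subgroup) auto

text \<open>Although \<open>derived_power G M d\<close> is a product of two sets, for a subset \<open>M\<close> it lies in a subgroup \<open>K\<close>
  exactly when the commutators and the \<open>d\<close>-th powers of elements of \<open>M\<close> do. All later uses of
  \<open>[M, M] M\<^sup>d\<close> go through this criterion.\<close>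

lemma (in group) derived_power_subset_iff:
  assumes M: "M \<subseteq> carrier G" and K: "subgroup K G"
  shows "derived_power G M d \<subseteq> K \<longleftrightarrow>
    (\<forall>x\<in>M. \<forall>y\<in>M. x \<otimes> y \<otimes> inv x \<otimes> inv y \<in> K) \<and> (\<forall>x\<in>M. x [^] d \<in> K)"
proof (intro iffI conjI ballI)
  note D = derived_is_subgroup[OF M] and P = power_subgroup_is_subgroup[OF M, of d]
  assume sub: "derived_power G M d \<subseteq> K"
  fix x assume x: "x \<in> M"
  have "\<one> \<otimes> x [^] d \<in> derived_power G M d"
    unfolding derived_power_def power_subgroup_def set_mult_def
    using subgroup.one_closed[OF D] x by (blast intro: generate.incl)
  then show "x [^] d \<in> K" using sub x M by (auto simp: subset_iff)
  fix y assume y: "y \<in> M"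
  have "x \<otimes> y \<otimes> inv x \<otimes> inv y \<otimes> \<one> \<in> derived_power G M d"
    unfolding derived_power_def set_mult_def derived_def
    using subgroup.one_closed[OF P] x y by (blast intro: generate.incl)
  then show "x \<otimes> y \<otimes> inv x \<otimes> inv y \<in> K" using sub x y M by (auto simp: subset_iff)
next
  assume *: "(\<forall>x\<in>M. \<forall>y\<in>M. x \<otimes> y \<otimes> inv x \<otimes> inv y \<in> K) \<and> (\<forall>x\<in>M. x [^] d \<in> K)"
  have "derived G M \<subseteq> K"
    unfolding derived_def using * K by (intro generate_subgroup_incl) auto
  moreover have "power_subgroup G M d \<subseteq> K"
    using * K by (intro power_subgroup_incl) auto
  ultimately show "derived_power G M d \<subseteq> K"
    unfolding derived_power_def set_mult_def using subgroup.m_closed[OF K] by blast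
qed

lemma (in group) derived_power_subset:
  assumes "subgroup M G"
  shows "derived_power G M d \<subseteq> M"
proof -
  interpret M: subgroup M G by fact
  show ?thesis
    using derived_power_subset_iff[OF M.subset assms] subgroup_nat_pow_closed[OF assms] by auto
qed

lemma (in group) derived_power_mono:
  assumes "A \<subseteq> B"
  shows "derived_power G A d \<subseteq> derived_power G B d"
  unfolding derived_power_def power_subgroup_def
  using assms by (intro mono_set_mult mono_derived mono_generate image_mono)

lemma (in group) derived_power_normal:
  assumes "M \<lhd> G"
  shows "derived_power G M d \<lhd> G"
proof -
  interpret M: normal M G by fact
  have conj_pow: "g \<otimes> x [^] d \<otimes> inv g = (g \<otimes> x \<otimes> inv g) [^] d"
    if "g \<in> carrier G" "x \<in> carrier G" for g x and d :: nat
  proof (induction d)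
    case (Suc d)
    have "(g \<otimes> x \<otimes> inv g) [^] Suc d = (g \<otimes> x [^] d \<otimes> inv g) \<otimes> (g \<otimes> x \<otimes> inv g)"
      by (simp add: Suc)
    also have "\<dots> = g \<otimes> x [^] d \<otimes> (inv g \<otimes> g) \<otimes> x \<otimes> inv g"
      using that by (simp only: m_assoc m_closed inv_closed nat_pow_closed)
    also have "\<dots> = g \<otimes> x [^] Suc d \<otimes> inv g"
      using that by (subst l_inv) (simp_all add: m_assoc)
    finally show ?case ..
  qed (use that in simp)
  have "power_subgroup G M d \<lhd> G"
    unfolding power_subgroup_def
  proof (rule normal_generateI)
    show "(\<lambda>x. x [^] d) ` M \<subseteq> carrier G" by auto
    fix h g assume "h \<in> (\<lambda>x. x [^] d) ` M" and g: "g \<in> carrier G"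
    then obtain x where x: "x \<in> M" "h = x [^] d" by auto
    then show "g \<otimes> h \<otimes> inv g \<in> (\<lambda>x. x [^] d) ` M"
      using conj_pow[OF g, of x d] M.inv_op_closed2[OF g x(1)] by auto
  qed
  then show ?thesis
    unfolding derived_power_def
    by (intro normal_subgroup_set_mult_closed derived_is_normal assms)
qed

lemma (in group) derived_power_consistent:
  assumes "subgroup M G"
  shows "derived_power (G\<lparr>carrier := M\<rparr>) M d = derived_power G M d"
proof -
  interpret M: subgroup M G by fact
  have "generate (G\<lparr>carrier := M\<rparr>) ((\<lambda>x. x [^] d) ` M) = generate G ((\<lambda>x. x [^] d) ` M)"
    using assms subgroup_nat_pow_closed[OF assms] by (intro generate_consistent) auto
  then show ?thesis
    unfolding derived_power_def power_subgroup_def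
    by (simp add: derived_consistent[OF order_refl assms] flip: nat_pow_consistent)
qed

lemma (in group_hom) derived_power_img:
  assumes "M \<subseteq> carrier G"
  shows "derived_power H (h ` M) d = h ` derived_power G M d"
proof -
  have "h ` ((\<lambda>x. x [^] d) ` M) = (\<lambda>x. x [^]\<^bsub>H\<^esub> d) ` (h ` M)"
    unfolding image_image using assms by (intro image_cong refl hom_nat_pow) auto
  then have pow: "power_subgroup H (h ` M) d = h ` power_subgroup G M d"
    unfolding power_subgroup_def using assms by (subst generate_img [symmetric]) auto
  have D: "derived G M \<subseteq> carrier G" and P: "power_subgroup G M d \<subseteq> carrier G"
    using G.derived_in_carrier[OF assms] G.power_subgroup_is_subgroup[OF assms, of d]
      subgroup.subset by auto
  show ?thesis
    unfolding derived_power_def pow derived_img[OF assms]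
    by (rule set_mult_hom[symmetric]) (use D P homh in auto)
qed

section \<open>Quotients in the classes\<close>

lemma (in normal) group_hom_Mod: "group_hom G (G Mod H) (\<lambda>x. H #> x)"
  by (simp add: group_hom_def group_hom_axioms_def is_group factorgroup_is_group r_coset_hom_Mod)

lemma (in normal) r_coset_eq_self_iff:
  assumes "x \<in> carrier G"
  shows "H #> x = H \<longleftrightarrow> x \<in> H"
  using assms coset_join1[OF _ assms subgroup_axioms] coset_join2[OF assms subgroup_axioms] subset
  by blast

lemma (in normal) r_coset_image_subset_iff:
  assumes "A \<subseteq> carrier G"
  shows "(\<lambda>x. H #> x) ` A \<subseteq> {H} \<longleftrightarrow> A \<subseteq> H"
proof -
  have "H #> x = H \<longleftrightarrow> x \<in> H" if "x \<in> A" for x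
    using that assms r_coset_eq_self_iff by blast
  then show ?thesis by blast
qed

lemma (in group) Ab_subgroup_iff:
  assumes "subgroup L G"
  shows "Ab d (G\<lparr>carrier := L\<rparr>) \<longleftrightarrow> finite L \<and> derived_power G L d \<subseteq> {\<one>}"
proof -
  interpret L: subgroup L G by fact
  have comm: "x \<otimes> y \<otimes> inv x \<otimes> inv y = \<one> \<longleftrightarrow> x \<otimes> y = y \<otimes> x" if "x \<in> L" "y \<in> L" for x y
    using that by (simp add: inv_solve_right' flip: m_assoc)
  have "comm_group (G\<lparr>carrier := L\<rparr>) \<longleftrightarrow> (\<forall>x\<in>L. \<forall>y\<in>L. x \<otimes> y = y \<otimes> x)"
  proof
    assume "comm_group (G\<lparr>carrier := L\<rparr>)"
    then interpret C: comm_group "G\<lparr>carrier := L\<rparr>" .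
    show "\<forall>x\<in>L. \<forall>y\<in>L. x \<otimes> y = y \<otimes> x" using C.m_comm by simp
  next
    assume "\<forall>x\<in>L. \<forall>y\<in>L. x \<otimes> y = y \<otimes> x"
    then show "comm_group (G\<lparr>carrier := L\<rparr>)"
      by (intro group.group_comm_groupI subgroup_imp_group assms) auto
  qed
  then show ?thesis
    unfolding Ab_def derived_power_subset_iff[OF L.subset triv_subgroup]
    using comm by (auto simp flip: nat_pow_consistent)
qed

lemma (in group) Ab_iff: "Ab d G \<longleftrightarrow> finite (carrier G) \<and> derived_power G (carrier G) d \<subseteq> {\<one>}"
  using Ab_subgroup_iff[OF subgroup_self] by simp

text \<open>By Lagrange's theorem in one direction and by Cauchy's theorem (a subgroup of prime order, from Sylow)
  in the other, a finite group is a \<open>p\<close>-group iff each element has \<open>p\<close>-power order. Unlike the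
  condition on the order of the group, this one is visibly inherited by subgroups and by subdirect products.\<close>

lemma (in group) p_groups_iff:
  assumes p: "prime p"
  shows "p_groups p G \<longleftrightarrow> finite (carrier G) \<and> (\<forall>x\<in>carrier G. \<exists>k. x [^] (p ^ k) = \<one>)"
proof
  assume "p_groups p G"
  then show "finite (carrier G) \<and> (\<forall>x\<in>carrier G. \<exists>k. x [^] (p ^ k) = \<one>)"
    unfolding p_groups_def by (metis pow_order_eq_1)
next
  assume *: "finite (carrier G) \<and> (\<forall>x\<in>carrier G. \<exists>k. x [^] (p ^ k) = \<one>)"
  have pos: "order G > 0" using * by (simp add: order_gt_0_iff_finite)
  have q: "q = p" if q: "prime q" "q dvd order G" for q
  proof -
    obtain m where "order G = q ^ 1 * m" using q(2) by (auto elim: dvdE)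
    then obtain L where L: "subgroup L G" "card L = q"
      using sylow_thm[OF q(1) is_group, of 1 m] * by auto
    interpret L: group "G\<lparr>carrier := L\<rparr>" using L by (simp add: subgroup_imp_group)
    have "L \<noteq> {\<one>}" using L prime_gt_1_nat[OF q(1)] by auto
    then obtain x where x: "x \<in> L" "x \<noteq> \<one>" using subgroup.one_closed[OF L(1)] by blast
    have xG: "x \<in> carrier G" using x subgroup.mem_carrier[OF L(1)] by blast
    have "x [^] q = \<one>"
      using L.pow_order_eq_1[of x] x L by (simp add: order_def flip: nat_pow_consistent)
    then have "ord x dvd q" using pow_eq_id[OF xG] by blast
    moreover obtain k where "x [^] (p ^ k) = \<one>" using * xG by blast
    then have "ord x dvd p ^ k" using pow_eq_id[OF xG] by blast
    moreover have "ord x \<noteq> 1" using ord_eq_1[OF xG] x by simp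
    ultimately have "q dvd p ^ k" using q(1) by (metis prime_nat_iff)
    then show "q = p" using q(1) p by (metis prime_dvd_power primes_dvd_imp_eq)
  qed
  obtain m where m: "order G = p ^ multiplicity p (order G) * m" "\<not> p dvd m"
    using pos p by (metis multiplicity_decompose' not_gr_zero not_prime_unit)
  have "m = 1"
  proof (rule ccontr)
    assume "m \<noteq> 1"
    then obtain r where "prime r" "r dvd m" using prime_factor_nat by blast
    then show False using q m by (metis dvd_mult)
  qed
  then show "p_groups p G" unfolding p_groups_def using * m is_group by (metis mult.right_neutral)
qed

text \<open>In the definition of \<open>U * Ab\<^sub>d\<close> the normal subgroup may be taken to be the smallest one with quotient
  in \<open>Ab\<^sub>d\<close>, namely \<open>[G, G] G\<^sup>d\<close>, provided that \<open>U\<close> is closed under subgroups.\<close>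

lemma (in group) class_prod_Ab_iff:
  assumes hereditary: "\<And>A B. \<lbrakk>subgroup A G; subgroup B G; A \<subseteq> B; U (G\<lparr>carrier := B\<rparr>)\<rbrakk>
    \<Longrightarrow> U (G\<lparr>carrier := A\<rparr>)"
  shows "class_prod U (Ab d) G \<longleftrightarrow>
    finite (carrier G) \<and> U (G\<lparr>carrier := derived_power G (carrier G) d\<rparr>)"
proof -
  have Ab_Mod: "Ab d (G Mod N) \<longleftrightarrow> derived_power G (carrier G) d \<subseteq> N"
    if "N \<lhd> G" "finite (carrier G)" for N
  proof -
    interpret N: normal N G by fact
    interpret Q: group "G Mod N" by (rule N.factorgroup_is_group)
    interpret h: group_hom G "G Mod N" "\<lambda>x. N #> x" by (rule N.group_hom_Mod)
    have D: "derived_power G (carrier G) d \<subseteq> carrier G"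
      by (simp add: derived_power_subset subgroup_self)
    have "derived_power (G Mod N) (carrier (G Mod N)) d
        = (\<lambda>x. N #> x) ` derived_power G (carrier G) d"
      using h.derived_power_img[of "carrier G"] by (simp add: carrier_FactGroup)
    then show ?thesis
      using N.r_coset_image_subset_iff[OF D] that(2) unfolding Q.Ab_iff
      by (simp add: carrier_FactGroup)
  qed
  let ?D = "derived_power G (carrier G) d"
  have D: "?D \<lhd> G" by (rule derived_power_normal[OF normal_self])
  show ?thesis
  proof
    assume "class_prod U (Ab d) G"
    then obtain N where N: "finite (carrier G)" "N \<lhd> G" "U (G\<lparr>carrier := N\<rparr>)" "Ab d (G Mod N)"
      unfolding class_prod_def by blast
    then show "finite (carrier G) \<and> U (G\<lparr>carrier := ?D\<rparr>)"
      using hereditary[of ?D N] D Ab_Mod[of N] by (auto intro: normal_imp_subgroup)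
  next
    assume "finite (carrier G) \<and> U (G\<lparr>carrier := ?D\<rparr>)"
    then show "class_prod U (Ab d) G"
      unfolding class_prod_def using D Ab_Mod[OF D] is_group by blast
  qed
qed

text \<open>The image of a subgroup \<open>M\<close> in \<open>G Mod H\<close> is taken as \<open>(\<lambda>x. H #> x) ` M\<close> rather than as a quotient of \<open>M\<close>,
  so that no isomorphism theorem is needed to pass between the two.\<close>

lemma (in normal) Ab_image_Mod_iff:
  assumes "subgroup M G"
  shows "Ab d ((G Mod H)\<lparr>carrier := (\<lambda>x. H #> x) ` M\<rparr>) \<longleftrightarrow>
    finite ((\<lambda>x. H #> x) ` M) \<and> derived_power G M d \<subseteq> H"
proof -
  interpret h: group_hom G "G Mod H" "\<lambda>x. H #> x" by (rule group_hom_Mod)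
  have "derived_power G M d \<subseteq> carrier G"
    using derived_power_subset[OF assms] subgroup.subset[OF assms] by blast
  then show ?thesis
    using r_coset_image_subset_iff h.derived_power_img[OF subgroup.subset[OF assms], of d]
    unfolding h.H.Ab_subgroup_iff[OF h.subgroup_img_is_subgroup[OF assms]]
    by simp
qed

lemma (in normal) Ab_Mod_iff:
  "Ab d (G Mod H) \<longleftrightarrow> finite (rcosets H) \<and> derived_power G (carrier G) d \<subseteq> H"
  using Ab_image_Mod_iff[OF subgroup_self, of d]
  by (simp flip: carrier_FactGroup) (simp add: FactGroup_def)

lemma (in normal) p_groups_image_Mod_iff:
  assumes "prime p" and M: "subgroup M G"
  shows "p_groups p ((G Mod H)\<lparr>carrier := (\<lambda>x. H #> x) ` M\<rparr>) \<longleftrightarrow>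
    finite ((\<lambda>x. H #> x) ` M) \<and> (\<forall>x\<in>M. \<exists>k. x [^] (p ^ k) \<in> H)"
proof -
  interpret h: group_hom G "G Mod H" "\<lambda>x. H #> x" by (rule group_hom_Mod)
  interpret I: group "(G Mod H)\<lparr>carrier := (\<lambda>x. H #> x) ` M\<rparr>"
    by (rule h.H.subgroup_imp_group[OF h.subgroup_img_is_subgroup[OF M]])
  have "(H #> x) [^]\<^bsub>G Mod H\<^esub> n = H \<longleftrightarrow> x [^] n \<in> H" if "x \<in> M" for x and n :: nat
    using that r_coset_eq_self_iff[of "x [^] n"] h.hom_nat_pow[of x n] subgroup.mem_carrier[OF M]
    by simp
  then show ?thesis
    unfolding I.p_groups_iff[OF assms(1)] by (simp flip: h.H.nat_pow_consistent)
qed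

lemma (in normal) class_prod_Ab_Ab_Mod_iff:
  "class_prod (Ab p) (Ab d) (G Mod H) \<longleftrightarrow>
    finite (rcosets H) \<and> derived_power G (derived_power G (carrier G) d) p \<subseteq> H"
proof -
  interpret h: group_hom G "G Mod H" "\<lambda>x. H #> x" by (rule group_hom_Mod)
  let ?D = "derived_power G (carrier G) d"
  have D: "subgroup ?D G" by (rule normal_imp_subgroup[OF derived_power_normal[OF normal_self]])
  have hD: "derived_power (G Mod H) (carrier (G Mod H)) d = (\<lambda>x. H #> x) ` ?D"
    using h.derived_power_img[of "carrier G"] by (simp add: carrier_FactGroup)
  have "class_prod (Ab p) (Ab d) (G Mod H) \<longleftrightarrow>
      finite (carrier (G Mod H)) \<and> Ab p ((G Mod H)\<lparr>carrier := (\<lambda>x. H #> x) ` ?D\<rparr>)"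
    unfolding hD[symmetric]
  proof (rule h.H.class_prod_Ab_iff)
    fix A B assume "subgroup A (G Mod H)" "subgroup B (G Mod H)" "A \<subseteq> B"
      "Ab p ((G Mod H)\<lparr>carrier := B\<rparr>)"
    then show "Ab p ((G Mod H)\<lparr>carrier := A\<rparr>)"
      using h.H.derived_power_mono[of A B p]
      by (auto simp del: one_FactGroup simp: h.H.Ab_subgroup_iff intro: finite_subset)
  qed
  moreover have "finite ((\<lambda>x. H #> x) ` ?D)" if "finite (carrier (G Mod H))"
    using finite_subset[OF image_mono[OF subgroup.subset[OF D]] that[unfolded carrier_FactGroup]] .
  ultimately show ?thesis
    unfolding Ab_image_Mod_iff[OF D] by (auto simp: FactGroup_def)
qed

lemma (in normal) H_groups_Mod_iff:
  assumes p: "prime p"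
  shows "H_groups p (G Mod H) \<longleftrightarrow> finite (rcosets H) \<and>
    (\<forall>x\<in>derived_power G (carrier G) (p - 1). \<exists>k. x [^] (p ^ k) \<in> H)"
proof -
  interpret h: group_hom G "G Mod H" "\<lambda>x. H #> x" by (rule group_hom_Mod)
  let ?D = "derived_power G (carrier G) (p - 1)"
  have D: "subgroup ?D G" by (rule normal_imp_subgroup[OF derived_power_normal[OF normal_self]])
  have hD: "derived_power (G Mod H) (carrier (G Mod H)) (p - 1) = (\<lambda>x. H #> x) ` ?D"
    using h.derived_power_img[of "carrier G"] by (simp add: carrier_FactGroup)
  have "H_groups p (G Mod H) \<longleftrightarrow>
      finite (carrier (G Mod H)) \<and> p_groups p ((G Mod H)\<lparr>carrier := (\<lambda>x. H #> x) ` ?D\<rparr>)"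
    unfolding hD[symmetric] H_groups_def
  proof (rule h.H.class_prod_Ab_iff)
    fix A B assume AB: "subgroup A (G Mod H)" "subgroup B (G Mod H)" "A \<subseteq> B"
      "p_groups p ((G Mod H)\<lparr>carrier := B\<rparr>)"
    interpret A: group "(G Mod H)\<lparr>carrier := A\<rparr>" by (rule h.H.subgroup_imp_group[OF AB(1)])
    interpret B: group "(G Mod H)\<lparr>carrier := B\<rparr>" by (rule h.H.subgroup_imp_group[OF AB(2)])
    show "p_groups p ((G Mod H)\<lparr>carrier := A\<rparr>)"
      using AB(3,4) unfolding A.p_groups_iff[OF p] B.p_groups_iff[OF p]
      by (auto simp flip: h.H.nat_pow_consistent intro: finite_subset)
  qed
  moreover have "finite ((\<lambda>x. H #> x) ` ?D)" if "finite (carrier (G Mod H))"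
    using finite_subset[OF image_mono[OF subgroup.subset[OF D]] that[unfolded carrier_FactGroup]] .
  ultimately show ?thesis
    unfolding p_groups_image_Mod_iff[OF p D] by (auto simp: FactGroup_def)
qed

section \<open>Density of subgroups\<close>

lemma (in group) rcosets_Int_finite:
  assumes "subgroup K G" "subgroup L G" "finite (rcosets K)" "finite (rcosets L)"
  shows "finite (rcosets (K \<inter> L))"
proof (rule finite_subset)
  have "(K \<inter> L) #> x = (K #> x) \<inter> (L #> x)" if "x \<in> carrier G" for x
    using that subgroup.subset[OF assms(1)] subgroup.subset[OF assms(2)]
    by (auto simp: r_coset_def subset_iff)
  then show "rcosets (K \<inter> L) \<subseteq> (\<lambda>(A, B). A \<inter> B) ` ((rcosets K) \<times> (rcosets L))"
    by (force simp: RCOSETS_def)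
qed (use assms in auto)

text \<open>If, for normal \<open>K\<close>, membership of \<open>G Mod K\<close> in \<open>V\<close> means that \<open>K\<close> has finite index and satisfies a property \<open>P\<close> that
  holds for \<open>carrier G\<close> and is preserved by intersections, then the cosets of such \<open>K\<close> really are a basis
  of a topology on \<open>carrier G\<close> (without these conditions \<open>pro_topology\<close> could be an arbitrary topology), and a
  subgroup \<open>H\<close> is dense iff it meets all cosets of each such \<open>K\<close>.\<close>

lemma (in group) pro_dense_iff:
  assumes H: "subgroup H G"
    and V: "\<And>K. K \<lhd> G \<Longrightarrow> V (G Mod K) \<longleftrightarrow> finite (rcosets K) \<and> P K"
    and P_carrier: "P (carrier G)" and P_Int: "\<And>K L. \<lbrakk>P K; P L\<rbrakk> \<Longrightarrow> P (K \<inter> L)"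
  shows "pro_dense V G H \<longleftrightarrow>
    (\<forall>K. K \<lhd> G \<and> finite (rcosets K) \<and> P K \<longrightarrow> H <#> K = carrier G)"
proof -
  define B where "B = (\<lambda>B. \<exists>K x. K \<lhd> G \<and> V (G Mod K) \<and> x \<in> carrier G \<and> B = K #> x)"
  have V_Int: "V (G Mod (K \<inter> L))" if "K \<lhd> G" "L \<lhd> G" "V (G Mod K)" "V (G Mod L)" for K L
    using that by (simp add: V normal_subgroup_intersect rcosets_Int_finite normal_imp_subgroup P_Int)
  have coset: "K #> x = K #> a \<and> x \<in> carrier G" if "x \<in> K #> a" "K \<lhd> G" "a \<in> carrier G" for K x a
    using that repr_independence[of x K a] r_coset_subset_G[of K a]
    by (auto dest: normal_imp_subgroup subgroup.subset)
  have self: "x \<in> K #> x" if "x \<in> carrier G" "K \<lhd> G" for x K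
    using that by (simp add: rcos_self normal_imp_subgroup)
  have top: "istopology (arbitrary union_of B)"
    unfolding istopology_base_eq arbitrary_union_of_alt
  proof (intro allI impI ballI)
    fix S T x assume "B S \<and> B T" and x: "x \<in> S \<inter> T"
    then obtain K a L b where K: "K \<lhd> G" "V (G Mod K)" "a \<in> carrier G" "S = K #> a"
      and L: "L \<lhd> G" "V (G Mod L)" "b \<in> carrier G" "T = L #> b"
      unfolding B_def by blast
    have xG: "x \<in> carrier G" and S: "S = K #> x" and T: "T = L #> x"
      using coset K L x by blast+
    have "B ((K \<inter> L) #> x)"
      unfolding B_def using K L xG V_Int normal_subgroup_intersect by blast
    moreover have "x \<in> (K \<inter> L) #> x" using self xG K L normal_subgroup_intersect by blast
    moreover have "(K \<inter> L) #> x \<subseteq> S \<inter> T" unfolding S T by (auto simp: r_coset_def)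
    ultimately show "\<exists>U. B U \<and> x \<in> U \<and> U \<subseteq> S \<inter> T" by blast
  qed
  have "openin (pro_topology V G) = (arbitrary union_of B)"
    unfolding pro_topology_def B_def[symmetric] by (rule topology_inverse'[OF top])
  then have openin: "openin (pro_topology V G) U \<longleftrightarrow> (\<forall>x\<in>U. \<exists>W. B W \<and> x \<in> W \<and> W \<subseteq> U)" for U
    by (simp add: arbitrary_union_of_alt)
  have open_coset: "openin (pro_topology V G) (K #> x)"
    if "K \<lhd> G" "finite (rcosets K)" "P K" "x \<in> carrier G" for K x
    using that V unfolding openin B_def by blast
  have one: "rcosets (carrier G) = {carrier G}"
    using coset_join2[OF _ subgroup_self] by (auto simp: RCOSETS_def)
  have "openin (pro_topology V G) (carrier G)"
    using open_coset[OF normal_self _ P_carrier one_closed] by (simp add: one)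
  moreover have "W \<subseteq> carrier G" if "B W" for W
    using that coset unfolding B_def by blast
  then have "U \<subseteq> carrier G" if "openin (pro_topology V G) U" for U
    using that unfolding openin by blast
  ultimately have topspace: "topspace (pro_topology V G) = carrier G"
    by (meson openin_subset openin_topspace subset_antisym)
  have HG: "H \<subseteq> carrier G" by (rule subgroup.subset[OF H])
  have meets: "(\<exists>h\<in>H. h \<in> K #> x) \<longleftrightarrow> x \<in> H <#> K" if K: "K \<lhd> G" and x: "x \<in> carrier G" for K x
  proof -
    interpret K: normal K G by fact
    have "H <#> K = K <#> H" by (rule commut_normal[OF H K])
    moreover have "x \<in> K <#> H" if h: "h \<in> H" "h \<in> K #> x" for h
    proof -
      obtain k where "k \<in> K" "h = k \<otimes> x" using h by (auto simp: r_coset_def)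
      then have "x = inv k \<otimes> h" "inv k \<in> K"
        using x by (simp_all flip: m_assoc)
      then show ?thesis using h by (auto simp: set_mult_def)
    qed
    moreover have "\<exists>h\<in>H. h \<in> K #> x" if xKH: "x \<in> K <#> H"
    proof -
      obtain k h where kh: "k \<in> K" "h \<in> H" "x = k \<otimes> h" using xKH by (auto simp: set_mult_def)
      then have "h = inv k \<otimes> x" "inv k \<in> K"
        using HG by (auto simp flip: m_assoc)
      then show ?thesis using kh by (auto simp: r_coset_def)
    qed
    ultimately show ?thesis by blast
  qed
  have mult_subset: "H <#> K \<subseteq> carrier G" if "K \<lhd> G" for K
    using that HG by (simp add: setmult_subset_G normal_imp_subgroup subgroup.subset)
  show ?thesis
  proof
    assume dense: "pro_dense V G H"
    show "\<forall>K. K \<lhd> G \<and> finite (rcosets K) \<and> P K \<longrightarrow> H <#> K = carrier G"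
    proof (intro allI impI, elim conjE)
      fix K assume K: "K \<lhd> G" "finite (rcosets K)" "P K"
      have "x \<in> H <#> K" if x: "x \<in> carrier G" for x
      proof -
        have "x \<in> pro_topology V G closure_of H" using dense x unfolding pro_dense_def by simp
        then have "\<exists>h\<in>H. h \<in> K #> x"
          using open_coset[OF K x] self[OF x K(1)] by (auto simp: in_closure_of)
        then show ?thesis using meets[OF K(1) x] by simp
      qed
      then show "H <#> K = carrier G" using mult_subset[OF K(1)] by blast
    qed
  next
    assume *: "\<forall>K. K \<lhd> G \<and> finite (rcosets K) \<and> P K \<longrightarrow> H <#> K = carrier G"
    have "x \<in> pro_topology V G closure_of H" if x: "x \<in> carrier G" for x
      unfolding in_closure_of topspace
    proof (intro conjI x allI impI)
      fix U assume "x \<in> U \<and> openin (pro_topology V G) U"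
      then obtain K a where K: "K \<lhd> G" "V (G Mod K)" "a \<in> carrier G" "x \<in> K #> a" "K #> a \<subseteq> U"
        unfolding openin B_def by blast
      then have "x \<in> H <#> K" using * V x by blast
      then show "\<exists>y. y \<in> H \<and> y \<in> U" using meets[OF K(1) x] coset[of x K a] K by blast
    qed
    then show "pro_dense V G H"
      unfolding pro_dense_def using HG closure_of_subset_topspace[of "pro_topology V G" H] topspace
      by auto
  qed
qed

text \<open>When the normal subgroups with quotient in \<open>V\<close> are those of finite index that contain \<open>M\<close>, and \<open>M\<close> is one
  of them, density is tested on \<open>M\<close> alone.\<close>

lemma (in group) pro_dense_iff_set_mult:
  assumes "subgroup H G" and M: "M \<lhd> G" "finite (rcosets M)"
    and V: "\<And>K. K \<lhd> G \<Longrightarrow> V (G Mod K) \<longleftrightarrow> finite (rcosets K) \<and> M \<subseteq> K"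
  shows "pro_dense V G H \<longleftrightarrow> H <#> M = carrier G"
proof -
  have MG: "M \<subseteq> carrier G" using M normal_imp_subgroup subgroup.subset by blast
  have "H <#> K = carrier G" if "H <#> M = carrier G" "K \<lhd> G" "M \<subseteq> K" for K
    using mono_set_mult[OF order_refl[of H] that(3), of G] that
      setmult_subset_G[of H K] assms(1) by (simp add: normal_imp_subgroup subgroup.subset)
  then show ?thesis
    using M pro_dense_iff[OF assms(1) V MG] by blast
qed

section \<open>Finite index\<close>

text \<open>Adjoining one generator \<open>a\<close> multiplies the generated subgroup by the finite cyclic group generated by \<open>a\<close>.\<close>

lemma (in comm_group) finite_generate_bounded_exponent:
  assumes "finite S" "S \<subseteq> carrier G" and "(d::nat) > 0" "\<And>x. x \<in> carrier G \<Longrightarrow> x [^] d = \<one>"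
  shows "finite (generate G S)"
  using assms(1,2)
proof (induction S)
  case empty
  then show ?case by (simp add: generate_empty)
next
  case (insert a S)
  have a: "a \<in> carrier G" and S: "S \<subseteq> carrier G" using insert by auto
  have A: "subgroup (generate G {a}) G" and B: "subgroup (generate G S) G"
    using a S by (auto intro: generate_is_subgroup)
  have AB: "subgroup (generate G {a} <#> generate G S) G" by (rule mult_subgroups[OF A B])
  have "ord a \<noteq> 0" using ord_eq_0[OF a] assms(3,4) a by blast
  then have "finite (generate G {a})"
    using generate_pow_card[OF a] by (metis card.infinite)
  moreover have "finite (generate G S)" using insert by simp
  ultimately have fin: "finite (generate G {a} <#> generate G S)" by (simp add: set_mult_def)
  have "a \<otimes> \<one> \<in> generate G {a} <#> generate G S"
    unfolding set_mult_def by (blast intro: generate.incl generate.one)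
  moreover have "\<one> \<otimes> s \<in> generate G {a} <#> generate G S" if "s \<in> S" for s
    unfolding set_mult_def using that by (blast intro: generate.incl generate.one)
  ultimately have "insert a S \<subseteq> generate G {a} <#> generate G S"
    using a S by (auto simp: subset_iff)
  then show ?case using finite_subset[OF generate_subgroup_incl[OF _ AB] fin] by blast
qed

lemma (in group) finite_rcosets_derived_power:
  assumes "fin_gen_subgroup (carrier G) G" "d > 0"
  shows "finite (rcosets (derived_power G (carrier G) d))"
proof -
  let ?D = "derived_power G (carrier G) d"
  interpret D: normal ?D G by (rule derived_power_normal[OF normal_self])
  interpret h: group_hom G "G Mod ?D" "\<lambda>x. ?D #> x" by (rule D.group_hom_Mod)
  let ?Q = "G Mod ?D"
  have carrier: "carrier ?Q = (\<lambda>x. ?D #> x) ` carrier G" by (rule carrier_FactGroup)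
  have "derived_power ?Q (carrier ?Q) d \<subseteq> {\<one>\<^bsub>?Q\<^esub>}"
    unfolding carrier h.derived_power_img[OF order_refl] one_FactGroup
      D.r_coset_image_subset_iff[OF D.subset] ..
  then have comm: "\<forall>x\<in>carrier ?Q. \<forall>y\<in>carrier ?Q.
        x \<otimes>\<^bsub>?Q\<^esub> y \<otimes>\<^bsub>?Q\<^esub> inv\<^bsub>?Q\<^esub> x \<otimes>\<^bsub>?Q\<^esub> inv\<^bsub>?Q\<^esub> y = \<one>\<^bsub>?Q\<^esub>"
    and pow: "\<forall>x\<in>carrier ?Q. x [^]\<^bsub>?Q\<^esub> d = \<one>\<^bsub>?Q\<^esub>"
    using h.H.derived_power_subset_iff[OF order_refl h.H.triv_subgroup] by auto
  have "x \<otimes>\<^bsub>?Q\<^esub> y = y \<otimes>\<^bsub>?Q\<^esub> x" if "x \<in> carrier ?Q" "y \<in> carrier ?Q" for x y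
    using comm that by (simp del: mult_FactGroup one_FactGroup add: h.H.inv_solve_right' flip: h.H.m_assoc)
  then interpret Q: comm_group ?Q by (rule h.H.group_comm_groupI)
  obtain S where S: "finite S" "S \<subseteq> carrier G" "generate G S = carrier G"
    using assms(1) unfolding fin_gen_subgroup_def by blast
  have "carrier ?Q = generate ?Q ((\<lambda>x. ?D #> x) ` S)"
    unfolding carrier h.generate_img[OF S(2)] S(3) ..
  moreover have "finite (generate ?Q ((\<lambda>x. ?D #> x) ` S))"
  proof (rule Q.finite_generate_bounded_exponent)
    show "(\<lambda>x. ?D #> x) ` S \<subseteq> carrier ?Q" using S(2) unfolding carrier by blast
  qed (use S assms(2) pow in auto)
  ultimately show ?thesis by (simp add: FactGroup_def)
qed

text \<open>Schreier's lemma. With a finite transversal \<open>T\<close> containing \<open>\<one>\<close>, a finite generating set \<open>S\<close>, and the subgroup \<open>U\<close>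
  generated by the elements \<open>t \<otimes> s \<otimes> inv t'\<close> that lie in \<open>N\<close>, the set \<open>U <#> T\<close> is stable under right
  multiplication by generators, hence is everything; an element of \<open>N\<close> then differs from one of \<open>U\<close> by an
  element of \<open>T \<inter> N\<close>. The elements of \<open>T \<inter> N\<close> are put among the generators by allowing \<open>s = \<one>\<close>, so that \<open>T\<close> may
  contain more than one representative of a coset.\<close>

lemma (in group) fin_gen_subgroup_finite_index:
  assumes "fin_gen_subgroup (carrier G) G" and N: "subgroup N G" and fin: "finite (rcosets N)"
  shows "fin_gen_subgroup N (G\<lparr>carrier := N\<rparr>)"
proof -
  interpret N: subgroup N G by fact
  obtain S where S: "finite S" "S \<subseteq> carrier G" "generate G S = carrier G"
    using assms(1) unfolding fin_gen_subgroup_def by blast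
  define T where "T = insert \<one> ((\<lambda>R. SOME x. x \<in> R) ` (rcosets N))"
  have "finite T" using fin by (simp add: T_def)
  have some: "(SOME x. x \<in> R) \<in> R" if "R \<in> rcosets N" for R
    using N.rcosets_non_empty[OF that] by (simp add: some_in_eq)
  then have TG: "T \<subseteq> carrier G"
    using N.rcosets_carrier[OF is_group] by (auto simp: T_def)
  have T: "\<exists>t\<in>T. g \<otimes> inv t \<in> N" if g: "g \<in> carrier G" for g
  proof -
    have R: "N #> g \<in> rcosets N" using g by (simp add: rcosetsI N.subset)
    let ?t = "SOME x. x \<in> N #> g"
    have t: "?t \<in> N #> g" by (rule some[OF R])
    then have tG: "?t \<in> carrier G" using r_coset_subset_G[OF N.subset g] by blast
    then have "g \<in> N #> ?t" using repr_independence[OF t g N] rcos_self[OF g N] by simp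
    then have "g \<otimes> inv ?t \<in> N" using N.rcos_module_imp[OF is_group tG] by simp
    then show ?thesis using R by (auto simp: T_def)
  qed
  define S' where "S' = insert \<one> (S \<union> m_inv G ` S)"
  have S'G: "S' \<subseteq> carrier G" using S by (auto simp: S'_def)
  define Z where "Z = (\<lambda>(t, s, t'). t \<otimes> s \<otimes> inv t') ` (T \<times> S' \<times> T) \<inter> N"
  have "finite Z" using \<open>finite T\<close> S by (simp add: Z_def S'_def)
  have ZN: "Z \<subseteq> N" by (simp add: Z_def)
  have ZG: "Z \<subseteq> carrier G" using ZN N.subset by blast
  let ?U = "generate G Z"
  have UG: "?U \<subseteq> carrier G" by (rule generate_incl[OF ZG])
  have step: "\<exists>u\<in>?U. \<exists>t'\<in>T. t \<otimes> s = u \<otimes> t'" if t: "t \<in> T" and s: "s \<in> S'" for t s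
  proof -
    have ts: "t \<in> carrier G" "s \<in> carrier G" using t s TG S'G by auto
    obtain t' where t': "t' \<in> T" "t \<otimes> s \<otimes> inv t' \<in> N" using T[of "t \<otimes> s"] ts by auto
    then have "t \<otimes> s \<otimes> inv t' \<in> Z" unfolding Z_def using t s by force
    moreover have "t \<otimes> s = t \<otimes> s \<otimes> inv t' \<otimes> t'" using ts t' TG by (auto simp: m_assoc subset_iff)
    ultimately show ?thesis using t'(1) by (blast intro: generate.incl)
  qed
  \<comment> \<open>The induction moves an element past an arbitrary \<open>t \<in> T\<close>; this makes the product case immediate.\<close>
  have push: "\<forall>t\<in>T. \<exists>u\<in>?U. \<exists>t'\<in>T. t \<otimes> g = u \<otimes> t'" if "g \<in> generate G S" for g
    using that
  proof induction
    case one
    then show ?case using step by (auto simp: S'_def)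
  next
    case (incl h)
    then show ?case using step by (auto simp: S'_def)
  next
    case (inv h)
    then show ?case using step by (auto simp: S'_def)
  next
    case (eng g1 g2)
    have g: "g1 \<in> carrier G" "g2 \<in> carrier G" using eng(1,2) S(3) by auto
    show ?case
    proof
      fix t assume t: "t \<in> T"
      obtain u t' where 1: "u \<in> ?U" "t' \<in> T" "t \<otimes> g1 = u \<otimes> t'" using eng t by blast
      obtain v t'' where 2: "v \<in> ?U" "t'' \<in> T" "t' \<otimes> g2 = v \<otimes> t''" using eng 1(2) by blast
      have "t \<in> carrier G" "t' \<in> carrier G" "t'' \<in> carrier G" "u \<in> carrier G" "v \<in> carrier G"
        using t 1 2 TG UG by auto
      then have "t \<otimes> (g1 \<otimes> g2) = u \<otimes> v \<otimes> t''"
        using g 1(3) 2(3) by (metis m_assoc)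
      then show "\<exists>u\<in>?U. \<exists>t'\<in>T. t \<otimes> (g1 \<otimes> g2) = u \<otimes> t'"
        using generate.eng[OF 1(1) 2(1)] 2(2) by blast
    qed
  qed
  have "N \<subseteq> ?U"
  proof
    fix n assume n: "n \<in> N"
    then have nG: "n \<in> carrier G" by simp
    have "\<one> \<in> T" by (simp add: T_def)
    then obtain u t where ut: "u \<in> ?U" "t \<in> T" "\<one> \<otimes> n = u \<otimes> t"
      using push[of n] nG S(3) by blast
    have uG: "u \<in> carrier G" and tG: "t \<in> carrier G" using ut UG TG by auto
    have "u \<in> N" using ut(1) generate_subgroup_incl[OF ZN N] by blast
    moreover have "t = inv u \<otimes> n" using ut(3) uG tG nG by (simp add: m_assoc[symmetric])
    ultimately have "t \<in> N" using n by simp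
    then have "t \<in> Z"
      unfolding Z_def using ut(2) tG \<open>\<one> \<in> T\<close>
      by (auto simp: S'_def intro!: image_eqI[of _ _ "(t, \<one>, \<one>)"])
    then have "t \<in> ?U" by (rule generate.incl)
    then show "n \<in> ?U" using generate.eng[OF ut(1)] ut(3) nG by simp
  qed
  then have "?U = N" using generate_subgroup_incl[OF ZN N] by blast
  then have "generate (G\<lparr>carrier := N\<rparr>) Z = N" using generate_consistent[OF ZN N] by simp
  then show ?thesis
    unfolding fin_gen_subgroup_def
    using \<open>finite Z\<close> ZN group.subgroup_self[OF subgroup_imp_group[OF N]] by auto
qed

lemma (in group) finite_rcosets_trans:
  assumes N: "subgroup N G" "finite (rcosets N)" and M: "subgroup M G" "M \<subseteq> N"
    and fin: "finite (rcosets\<^bsub>G\<lparr>carrier := N\<rparr>\<^esub> M)"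
  shows "finite (rcosets M)"
proof -
  interpret N: subgroup N G by fact
  have "rcosets M \<subseteq> (\<lambda>(R, S). R #> (SOME x. x \<in> S)) ` ((rcosets\<^bsub>G\<lparr>carrier := N\<rparr>\<^esub> M) \<times> (rcosets N))"
  proof
    fix C assume "C \<in> rcosets M"
    then obtain g where g: "g \<in> carrier G" "C = M #> g" by (auto simp: RCOSETS_def)
    have R: "N #> g \<in> rcosets N" using g by (simp add: rcosetsI N.subset)
    define t where "t = (SOME x. x \<in> N #> g)"
    have t: "t \<in> N #> g" unfolding t_def using N.rcosets_non_empty[OF R] by (simp add: some_in_eq)
    then have tG: "t \<in> carrier G" using r_coset_subset_G[OF N.subset g(1)] by blast
    have "g \<in> N #> t" using repr_independence[OF t g(1) N(1)] rcos_self[OF g(1) N(1)] by simp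
    then obtain n where n: "n \<in> N" "g = n \<otimes> t" by (auto simp: r_coset_def)
    have "C = (M #> n) #> t"
      using n tG g by (simp add: coset_mult_assoc subgroup.subset[OF M(1)])
    moreover have "M #> n \<in> rcosets\<^bsub>G\<lparr>carrier := N\<rparr>\<^esub> M"
      using n by (auto simp: RCOSETS_def)
    ultimately show "C \<in> (\<lambda>(R, S). R #> (SOME x. x \<in> S)) ` ((rcosets\<^bsub>G\<lparr>carrier := N\<rparr>\<^esub> M) \<times> (rcosets N))"
      using R t_def by force
  qed
  then show ?thesis using fin N(2) finite_subset by blast
qed

section \<open>Non-generators of finite p-groups\<close>

lemma (in group_action) prime_dvd_card_fixed_points:
  assumes p: "prime p" and order: "order G = p ^ n" and E: "finite E" "p dvd card E"
  shows "p dvd card {x \<in> E. \<forall>g\<in>carrier G. \<phi> g x = x}"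
proof -
  interpret group G using group_hom group_hom.axioms(1) by blast
  let ?Fix = "{x \<in> E. \<forall>g\<in>carrier G. \<phi> g x = x}" and ?O = "orbits G E \<phi>"
  have fin: "finite ?O" using E(1) by (simp add: orbits_def)
  have card_E: "card E = (\<Sum>R\<in>?O. card R)"
    using disjoint_sum[OF E(1), of "\<lambda>_. 1::nat"] by simp
  have orbit_card: "card (orbit G \<phi> x) = 1 \<or> p dvd card (orbit G \<phi> x)" if "x \<in> E" for x
  proof -
    have "card (orbit G \<phi> x) dvd p ^ n"
      using orbit_stabilizer_theorem[OF that] order by (metis dvd_triv_left)
    then obtain i where "card (orbit G \<phi> x) = p ^ i" using p by (auto simp: divides_primepow_nat)
    then show ?thesis by (cases i) auto
  qed
  have "?O - {R \<in> ?O. card R = 1} = {R \<in> ?O. card R \<noteq> 1}" by blast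
  then have "card E = (\<Sum>R\<in>{R \<in> ?O. card R \<noteq> 1}. card R) + (\<Sum>R\<in>{R \<in> ?O. card R = 1}. card R)"
    unfolding card_E using sum.subset_diff[of "{R \<in> ?O. card R = 1}" ?O card] fin by simp
  moreover have "p dvd (\<Sum>R\<in>{R \<in> ?O. card R \<noteq> 1}. card R)"
    by (rule dvd_sum) (use orbit_card in \<open>auto simp: orbits_def\<close>)
  ultimately have "p dvd (\<Sum>R\<in>{R \<in> ?O. card R = 1}. card R)"
    using E(2) by (simp add: dvd_add_right_iff)
  then have "p dvd card {R \<in> ?O. card R = 1}" by simp
  moreover have "{R \<in> ?O. card R = 1} = (\<lambda>x. {x}) ` ?Fix"
  proof (intro equalityI subsetI)
    fix A assume "A \<in> {R \<in> ?O. card R = 1}"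
    then obtain x where x: "x \<in> E" "A = orbit G \<phi> x" "card A = 1" by (auto simp: orbits_def)
    then have A: "A = {x}" using orbit_refl[OF x(1)] by (auto simp: card_1_singleton_iff)
    then have "\<forall>g\<in>carrier G. \<phi> g x = x" using x(2) by (auto simp: orbit_def)
    then show "A \<in> (\<lambda>x. {x}) ` ?Fix" using A x(1) by blast
  next
    fix A assume "A \<in> (\<lambda>x. {x}) ` ?Fix"
    then obtain x where x: "A = {x}" "x \<in> E" "\<forall>g\<in>carrier G. \<phi> g x = x" by blast
    then have "orbit G \<phi> x = {x}" using orbit_refl[OF x(2)] by (auto simp: orbit_def)
    then show "A \<in> {R \<in> ?O. card R = 1}" using x by (auto simp: orbits_def)
  qed
  ultimately show ?thesis by (simp add: card_image)
qed

text \<open>Right multiplication is a right action; inverting the group element turns it into a left one.\<close>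

lemma (in group) action_on_rcosets:
  assumes A: "subgroup A G"
  shows "group_action G (rcosets A) (\<lambda>g. \<lambda>R\<in>rcosets A. R #> inv g)"
proof -
  interpret A: subgroup A G by fact
  have sub: "R \<subseteq> carrier G" if "R \<in> rcosets A" for R
    using A.rcosets_carrier[OF is_group that] .
  have closed: "R #> g \<in> rcosets A" if "R \<in> rcosets A" "g \<in> carrier G" for R g
    using that by (auto simp: RCOSETS_def coset_mult_assoc A.subset)
  have cancel: "R #> g #> inv g = R" "R #> inv g #> g = R"
    if "R \<in> rcosets A" "g \<in> carrier G" for R g
    using that sub by (simp_all add: coset_mult_assoc)
  have bij: "(\<lambda>R\<in>rcosets A. R #> inv g) \<in> Bij (rcosets A)" if "g \<in> carrier G" for g
  proof -
    have "bij_betw (\<lambda>R. R #> inv g) (rcosets A) (rcosets A)"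
      by (rule bij_betw_byWitness[where f' = "\<lambda>R. R #> g"]) (use that cancel closed in auto)
    then have "bij_betw (\<lambda>R\<in>rcosets A. R #> inv g) (rcosets A) (rcosets A)"
      by (simp cong: bij_betw_cong)
    then show ?thesis by (simp add: Bij_def)
  qed
  have "(\<lambda>g. \<lambda>R\<in>rcosets A. R #> inv g) \<in> hom G (BijGroup (rcosets A))"
  proof (rule homI)
    fix g h assume gh: "g \<in> carrier G" "h \<in> carrier G"
    have "(\<lambda>R\<in>rcosets A. R #> inv (g \<otimes> h))
        = compose (rcosets A) (\<lambda>R\<in>rcosets A. R #> inv g) (\<lambda>R\<in>rcosets A. R #> inv h)"
      unfolding compose_def
      using gh sub closed by (auto simp: inv_mult_group coset_mult_assoc intro!: restrict_ext)
    then show "(\<lambda>R\<in>rcosets A. R #> inv (g \<otimes> h)) = (\<lambda>R\<in>rcosets A. R #> inv g)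
        \<otimes>\<^bsub>BijGroup (rcosets A)\<^esub> (\<lambda>R\<in>rcosets A. R #> inv h)"
      using gh bij by (simp add: BijGroup_def)
  qed (use bij in \<open>simp add: BijGroup_def\<close>)
  then show ?thesis
    by (simp add: group_action_def group_hom_def group_hom_axioms_def is_group group_BijGroup)
qed

text \<open>Normalizers grow in \<open>p\<close>-groups: \<open>A\<close> acts on its right cosets and fixes the coset \<open>A\<close>, so by
  counting modulo \<open>p\<close> it fixes a further coset \<open>A #> x\<close>, which means that \<open>x\<close> conjugates \<open>A\<close> into itself.\<close>

lemma (in group) p_group_proper_subgroup_normalized:
  assumes p: "prime p" and order: "order G = p ^ n" and A: "subgroup A G" "A \<noteq> carrier G"
  shows "\<exists>x\<in>carrier G - A. \<forall>a\<in>A. x \<otimes> a \<otimes> inv x \<in> A"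
proof -
  interpret A: subgroup A G by fact
  have fin: "finite (carrier G)"
    using order p by (metis order_gt_0_iff_finite prime_gt_0_nat zero_less_power)
  have lagr: "card (rcosets A) * card A = p ^ n" using lagrange[OF A(1)] order by simp
  then obtain i where i: "card (rcosets A) = p ^ i" using p
    by (metis divides_primepow_nat dvd_triv_left)
  have "card A \<noteq> p ^ n" using A(2) fin A.subset order by (metis card_subset_eq order_def)
  then have "i \<noteq> 0" using lagr i by (cases i) auto
  then have dvd: "p dvd card (rcosets A)" using i by simp
  have fin_r: "finite (rcosets A)" using fin by (simp add: RCOSETS_def)
  obtain j where j: "card A = p ^ j" using lagr p by (metis divides_primepow_nat dvd_triv_right)
  let ?\<phi> = "\<lambda>g. \<lambda>R\<in>rcosets A. R #> inv g"
  interpret act: group_action "G\<lparr>carrier := A\<rparr>" "rcosets A" ?\<phi>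
    by (rule group_action.induced_action[OF action_on_rcosets[OF A(1)] A(1)])
  let ?Fix = "{R \<in> rcosets A. \<forall>a\<in>carrier (G\<lparr>carrier := A\<rparr>). ?\<phi> a R = R}"
  have "p dvd card ?Fix"
    using act.prime_dvd_card_fixed_points[OF p _ fin_r dvd, of j] j by (simp add: order_def)
  have A_mem: "A \<in> rcosets A" by (rule A.subgroup_in_rcosets[OF is_group])
  then have AFix: "A \<in> ?Fix" using coset_join2[OF _ A(1)] by simp
  have "card ?Fix \<noteq> 1" using \<open>p dvd card ?Fix\<close> prime_gt_1_nat[OF p] by (metis nat_dvd_1_iff_1 less_irrefl)
  then have "?Fix \<noteq> {A}" by (metis is_singletonI is_singleton_altdef)
  then obtain R where R: "R \<in> ?Fix" "R \<noteq> A" using AFix by blast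
  then obtain x where x: "x \<in> carrier G" "R = A #> x" by (auto simp: RCOSETS_def)
  have "x \<notin> A" using R(2) x coset_join2[OF _ A(1)] by auto
  moreover have "x \<otimes> a \<otimes> inv x \<in> A" if a: "a \<in> A" for a
  proof -
    have "R \<in> rcosets A" using R(1) by simp
    then have "\<forall>b\<in>A. R #> inv b = R" using R(1) by simp
    then have "R #> inv (inv a) = R" using A.m_inv_closed[OF a] by blast
    then have "A #> x #> inv (inv a) = A #> x" using x by simp
    then have "A #> (x \<otimes> a) = A #> x" using a x by (simp add: coset_mult_assoc A.subset)
    then have "x \<otimes> a \<in> A #> x" using rcos_self[of "x \<otimes> a" A] a x A(1) by simp
    then show ?thesis using A.rcos_module_imp[OF is_group x(1)] by simp
  qed
  ultimately show ?thesis using x by blast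
qed

lemma (in group) Ab_prime_order:
  assumes p: "prime p" and order: "order G = p"
  shows "Ab p G"
proof -
  have fin: "finite (carrier G)"
    using order p by (metis order_gt_0_iff_finite prime_gt_0_nat)
  have "carrier G \<noteq> {\<one>}" using order prime_gt_1_nat[OF p] by (auto simp: order_def)
  then obtain y where y: "y \<in> carrier G" "y \<noteq> \<one>" by blast
  have "ord y = p"
    using ord_dvd_group_order[OF y(1)] order p ord_eq_1[OF y(1)] y(2) by (metis prime_nat_iff)
  then have "card (generate G {y}) = card (carrier G)"
    using generate_pow_card[OF y(1)] order by (simp add: order_def)
  then have "generate G {y} = carrier G"
    using card_subset_eq[OF fin] generate_incl[of "{y}"] y by simp
  then have gen: "carrier G = {y [^] (k::int) | k. k \<in> UNIV}"
    using generate_pow[OF y(1)] by simp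
  have "comm_group G"
  proof (rule group_comm_groupI)
    fix u v assume "u \<in> carrier G" "v \<in> carrier G"
    then obtain k l :: int where "u = y [^] k" "v = y [^] l" using gen by blast
    then show "u \<otimes> v = v \<otimes> u" using y(1) by (simp add: add.commute flip: int_pow_mult)
  qed
  then show ?thesis unfolding Ab_def using fin pow_order_eq_1 order by auto
qed

text \<open>A maximal subgroup \<open>B\<close> that contains \<open>A\<close> is smaller than its normalizer, which is therefore the whole
  group; and \<open>G Mod B\<close> has prime order, since by Sylow it has a subgroup of
  order \<open>p\<close>, whose preimage is larger than \<open>B\<close>. So \<open>G Mod B\<close> is in \<open>Ab\<^sub>p\<close>.\<close>

lemma (in group) p_group_maximal_subgroup:
  assumes p: "prime p" and order: "order G = p ^ n" and A: "subgroup A G" "A \<noteq> carrier G"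
  shows "\<exists>B. subgroup B G \<and> A \<subseteq> B \<and> B \<noteq> carrier G \<and> derived_power G (carrier G) p \<subseteq> B"
proof -
  have fin: "finite (carrier G)"
    using order p by (metis order_gt_0_iff_finite prime_gt_0_nat zero_less_power)
  let ?S = "{B. subgroup B G \<and> B \<noteq> carrier G}"
  have "finite ?S"
    by (rule finite_subset[of _ "Pow (carrier G)"]) (use fin subgroup.subset in auto)
  moreover have "A \<in> ?S" using A by simp
  ultimately have "\<exists>B\<in>?S. A \<subseteq> B \<and> (\<forall>C\<in>?S. B \<subseteq> C \<longrightarrow> B = C)"
    by (rule finite_has_maximal2)
  then obtain B where BS: "B \<in> ?S" and AB: "A \<subseteq> B \<and> (\<forall>C\<in>?S. B \<subseteq> C \<longrightarrow> B = C)"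
    by (rule bexE)
  note maxB = conjunct2[OF AB]
  have B: "subgroup B G" "B \<noteq> carrier G" "A \<subseteq> B" using BS conjunct1[OF AB] by auto
  have max: "C = B" if "subgroup C G" "C \<noteq> carrier G" "B \<subseteq> C" for C
    using maxB that by blast
  interpret B: subgroup B G by fact
  have mem_normalizer: "g \<in> normalizer G B \<longleftrightarrow> g \<in> carrier G \<and> (\<lambda>b. g \<otimes> b \<otimes> inv g) ` B = B" for g
  proof -
    have "g <# B #> inv g = (\<lambda>b. g \<otimes> b \<otimes> inv g) ` B"
      by (auto simp: l_coset_def r_coset_def)
    then show ?thesis by (auto simp: normalizer_def stabilizer_def B.subset)
  qed
  have normalizerI: "g \<in> normalizer G B" if g: "g \<in> carrier G" "\<forall>b\<in>B. g \<otimes> b \<otimes> inv g \<in> B" for g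
  proof -
    have "inj_on (\<lambda>b. g \<otimes> b \<otimes> inv g) B" using g(1) by (auto intro!: inj_onI)
    then have "(\<lambda>b. g \<otimes> b \<otimes> inv g) ` B = B"
      using g finite_subset[OF B.subset fin] by (intro endo_inj_surj) auto
    then show ?thesis using g mem_normalizer by blast
  qed
  obtain x where x: "x \<in> carrier G" "x \<notin> B" "\<forall>b\<in>B. x \<otimes> b \<otimes> inv x \<in> B"
    using p_group_proper_subgroup_normalized[OF p order B(1,2)] by blast
  have "B \<subseteq> normalizer G B" using normalizerI by auto
  then have "normalizer G B = carrier G"
    using max[OF normalizer_imp_subgroup[OF B.subset]] x normalizerI by blast
  then have "B \<lhd> G" using mem_normalizer by (intro normal_invI B(1)) blast
  then interpret B: normal B G .
  interpret Q: group "G Mod B" by (rule B.factorgroup_is_group)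
  interpret h: group_hom G "G Mod B" "\<lambda>x. B #> x" by (rule B.group_hom_Mod)
  have finQ: "finite (carrier (G Mod B))" using fin by (simp add: carrier_FactGroup)
  have lagr: "order (G Mod B) * card B = p ^ n"
    using lagrange[OF B(1)] order by (simp add: order_def FactGroup_def)
  then obtain i where i: "order (G Mod B) = p ^ i" using p
    by (metis divides_primepow_nat dvd_triv_left)
  have "card B \<noteq> p ^ n" using B(2) fin B.subset order by (metis card_subset_eq order_def)
  then have "i \<noteq> 0" using lagr i by (cases i) auto
  then have "order (G Mod B) = p ^ 1 * p ^ (i - 1)" using i by (simp flip: power_Suc)
  then obtain L where L: "subgroup L (G Mod B)" "card L = p"
    using sylow_thm[OF p B.factorgroup_is_group, of 1] finQ by auto
  interpret L: subgroup L "G Mod B" by fact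
  let ?C = "{g \<in> carrier G. B #> g \<in> L}"
  have C: "subgroup ?C G"
    using L.one_closed by unfold_locales (auto simp: h.hom_mult simp del: mult_FactGroup)
  have BC: "B \<subseteq> ?C" using L.one_closed coset_join2[OF _ B(1)] by auto
  have imgC: "L = (\<lambda>x. B #> x) ` ?C" using L.subset by (auto simp: carrier_FactGroup)
  have "?C \<noteq> B"
  proof
    assume "?C = B"
    then have "L \<subseteq> {B}" using imgC B.r_coset_image_subset_iff[OF B.subset] by simp
    then have "card L \<le> 1" using card_mono[of "{B}" L] by simp
    then show False using L(2) prime_gt_1_nat[OF p] by simp
  qed
  then have "?C = carrier G" using max[OF C _ BC] by blast
  then have "L = carrier (G Mod B)" using imgC by (simp add: carrier_FactGroup)
  then have "Ab p (G Mod B)" using L(2) by (intro Q.Ab_prime_order p) (simp add: order_def)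
  then have "derived_power G (carrier G) p \<subseteq> B" using B.Ab_Mod_iff by blast
  then show ?thesis using B(1-3) by blast
qed

text \<open>The half of the Burnside basis theorem that is used here: \<open>[G, G] G\<^sup>p\<close> consists of non-generators of the
  finite \<open>p\<close>-group \<open>G\<close>.\<close>

lemma (in group) p_group_nongenerators:
  assumes p: "prime p" and "p_groups p G" and A: "subgroup A G"
    and gen: "A <#> derived_power G (carrier G) p = carrier G"
  shows "A = carrier G"
proof (rule ccontr)
  assume "A \<noteq> carrier G"
  moreover obtain n where "order G = p ^ n" using assms(2) by (auto simp: p_groups_def)
  ultimately obtain B where B: "subgroup B G" "A \<subseteq> B" "B \<noteq> carrier G"
    "derived_power G (carrier G) p \<subseteq> B"
    using p_group_maximal_subgroup[OF p _ A] by blast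
  have "carrier G \<subseteq> B"
    using mono_set_mult[OF B(2,4), of G] gen subgroup_mult_id[OF B(1)] by simp
  then show False using B subgroup.subset by blast
qed

section \<open>Equivalent conditions for density\<close>

text \<open>Dedekind's modular law, in the case that \<open>H <#> M\<close> is the whole group.\<close>

lemma (in group) set_mult_Int_eq:
  assumes "subgroup H G" and N: "subgroup N G" and M: "M \<subseteq> N" and HM: "H <#> M = carrier G"
  shows "(H \<inter> N) <#> M = N"
proof
  interpret H: subgroup H G by fact
  interpret N: subgroup N G by fact
  show "(H \<inter> N) <#> M \<subseteq> N" using M by (auto simp: set_mult_def)
  show "N \<subseteq> (H \<inter> N) <#> M"
  proof
    fix n assume n: "n \<in> N"
    then have "n \<in> H <#> M" using HM by simp
    then obtain h m where hm: "h \<in> H" "m \<in> M" "n = h \<otimes> m" by (auto simp: set_mult_def)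
    then have "h = n \<otimes> inv m" using M by (auto simp: m_assoc)
    moreover have "n \<otimes> inv m \<in> N" using n hm(2) M by auto
    ultimately have "h \<in> N" by simp
    then show "n \<in> (H \<inter> N) <#> M" using hm by (auto simp: set_mult_def)
  qed
qed

lemma (in group) set_mult_eq_carrierI:
  assumes H: "subgroup H G" and N: "H <#> N = carrier G"
    and M: "M \<subseteq> carrier G" "N \<subseteq> H <#> M"
  shows "H <#> M = carrier G"
proof -
  have "carrier G \<subseteq> H <#> (H <#> M)" 
    unfolding N[symmetric] by (intro mono_set_mult order_refl M(2))
  also have "\<dots> = H <#> M"
    using set_mult_assoc[OF subgroup.subset[OF H] subgroup.subset[OF H] M(1)]
      subgroup_mult_id[OF H] by simp
  finally show ?thesis using setmult_subset_G[OF subgroup.subset[OF H] M(1)] by blast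
qed

text \<open>The decisive step. Modulo \<open>K\<close> the subgroup \<open>N\<close> becomes a finite \<open>p\<close>-group, in which the image of \<open>H \<inter> N\<close>
  together with non-generators generates everything; so \<open>H \<inter> N\<close> and \<open>N\<close> have the same image.\<close>

lemma (in group) set_mult_eq_carrier_of_p_power_mod:
  assumes p: "prime p" and H: "subgroup H G" and N: "subgroup N G"
    and HM: "H <#> derived_power G N p = carrier G"
    and K: "K \<lhd> G" "finite (rcosets K)" and pow: "\<forall>x\<in>N. \<exists>k. x [^] (p ^ k) \<in> K"
  shows "H <#> K = carrier G"
proof -
  interpret K: normal K G by fact
  interpret N: subgroup N G by fact
  interpret h: group_hom G "G Mod K" "\<lambda>x. K #> x" by (rule K.group_hom_Mod)
  let ?\<pi> = "\<lambda>x. K #> x" and ?M = "derived_power G N p"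
  let ?I = "(G Mod K)\<lparr>carrier := ?\<pi> ` N\<rparr>"
  have MN: "?M \<subseteq> N" by (rule derived_power_subset[OF N])
  have HG: "H \<subseteq> carrier G" using H subgroup.subset by blast
  have I: "subgroup (?\<pi> ` N) (G Mod K)" by (rule h.subgroup_img_is_subgroup[OF N])
  interpret I: group ?I by (rule h.H.subgroup_imp_group[OF I])
  have "finite (?\<pi> ` N)"
    using K(2) finite_subset[OF image_mono[OF N.subset], of ?\<pi>]
    by (simp add: FactGroup_def flip: carrier_FactGroup)
  then have pI: "p_groups p ?I" using pow K.p_groups_image_Mod_iff[OF p N] by blast
  have HN: "(H \<inter> N) <#> ?M = N" by (rule set_mult_Int_eq[OF H N MN HM])
  have A: "subgroup (?\<pi> ` (H \<inter> N)) (G Mod K)"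
    by (intro h.subgroup_img_is_subgroup subgroups_Inter_pair H N)
  have \<pi>HN: "?\<pi> ` (H \<inter> N) <#>\<^bsub>G Mod K\<^esub> ?\<pi> ` ?M = ?\<pi> ` N"
    using set_mult_hom[OF h.homh, of "H \<inter> N" ?M] HN HG MN N.subset by (simp add: subset_iff)
  have \<pi>M: "derived_power ?I (carrier ?I) p = ?\<pi> ` ?M"
    using h.H.derived_power_consistent[OF I] h.derived_power_img[OF N.subset] by simp
  have "?\<pi> ` (H \<inter> N) = carrier ?I"
  proof (rule I.p_group_nongenerators[OF p pI])
    show "subgroup (?\<pi> ` (H \<inter> N)) ?I"
      by (rule h.H.subgroup_incl[OF A I]) blast
    show "?\<pi> ` (H \<inter> N) <#>\<^bsub>?I\<^esub> derived_power ?I (carrier ?I) p = carrier ?I"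
      unfolding \<pi>M set_mult_consistent \<pi>HN by simp
  qed
  then have img: "?\<pi> ` (H \<inter> N) = ?\<pi> ` N" by simp
  have "N \<subseteq> H <#> K"
  proof
    fix n assume n: "n \<in> N"
    then obtain h where h: "h \<in> H" "K #> n = K #> h" using img by blast
    have "n \<in> K #> h" using rcos_self[OF _ K.subgroup_axioms, of n] n h(2) by simp
    then have "n \<in> K <#> H" using h(1) by (auto simp: r_coset_def set_mult_def)
    then show "n \<in> H <#> K" using commut_normal[OF H K(1)] by simp
  qed
  then show ?thesis
    using MN by (intro set_mult_eq_carrierI[OF H HM K.subset]) blast
qed

text \<open>The condition on \<open>K\<close> passes to intersections: if \<open>x\<close> has a \<open>p\<close>-power in \<open>K\<close> and one in \<open>L\<close>, then the
  product of the two exponents gives a \<open>p\<close>-power of \<open>x\<close> in \<open>K \<inter> L\<close>.\<close>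

lemma (in group) pro_dense_H_groups_iff:
  assumes H: "subgroup H G" and p: "prime p"
  shows "pro_dense (H_groups p) G H \<longleftrightarrow>
    (\<forall>K. K \<lhd> G \<and> finite (rcosets K) \<and>
      (\<forall>x\<in>derived_power G (carrier G) (p - 1). \<exists>k. x [^] (p ^ k) \<in> K) \<longrightarrow> H <#> K = carrier G)"
proof -
  let ?N = "derived_power G (carrier G) (p - 1)"
  let ?P = "\<lambda>K. K \<lhd> G \<and> (\<forall>x\<in>?N. \<exists>k. x [^] (p ^ k) \<in> K)"
  have NG: "?N \<subseteq> carrier G" by (rule derived_power_subset[OF subgroup_self])
  have "pro_dense (H_groups p) G H \<longleftrightarrow>
    (\<forall>K. K \<lhd> G \<and> finite (rcosets K) \<and> ?P K \<longrightarrow> H <#> K = carrier G)"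
  proof (rule pro_dense_iff[OF H])
    fix K assume "K \<lhd> G"
    then show "H_groups p (G Mod K) \<longleftrightarrow> finite (rcosets K) \<and> ?P K"
      using normal.H_groups_Mod_iff[OF _ p] by blast
  next
    show "?P (carrier G)" using NG normal_self by blast
  next
    fix K L assume K: "?P K" and L: "?P L"
    have "\<exists>k. x [^] (p ^ k) \<in> K \<inter> L" if x: "x \<in> ?N" for x
    proof -
      have xG: "x \<in> carrier G" using x NG by blast
      obtain k l where kl: "x [^] (p ^ k) \<in> K" "x [^] (p ^ l) \<in> L" using K L x by blast
      have "x [^] (p ^ (k + l)) = (x [^] (p ^ k)) [^] (p ^ l)"
        "x [^] (p ^ (k + l)) = (x [^] (p ^ l)) [^] (p ^ k)"
        using xG by (simp_all add: nat_pow_pow power_add mult.commute)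
      then show ?thesis
        using kl K L by (metis IntI normal_imp_subgroup subgroup_nat_pow_closed)
    qed
    then show "?P (K \<inter> L)" using K L normal_subgroup_intersect by blast
  qed
  then show ?thesis by blast
qed

theorem theorem3p14:
  fixes F :: "('a, 'b) monoid_scheme" and H N :: "'a set" and p :: nat
  assumes "free_group F"
    and "fin_gen_subgroup (carrier F) F"
    and "fin_gen_subgroup H F"
    and "prime p"
    and "N = derived_power F (carrier F) (p - 1)"
  shows "(pro_dense (H_groups p) F H
            \<longleftrightarrow> pro_dense (class_prod (Ab p) (Ab (p - 1))) F H) \<and>
         (pro_dense (class_prod (Ab p) (Ab (p - 1))) F H
            \<longleftrightarrow> H <#>\<^bsub>F\<^esub> derived_power F N p = carrier F) \<and>
         (H <#>\<^bsub>F\<^esub> derived_power F N p = carrier F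
            \<longleftrightarrow> pro_dense (Ab (p - 1)) F H \<and> pro_dense (Ab p) (F\<lparr>carrier := N\<rparr>) (H \<inter> N))"
proof -
  interpret F: group F using assms(1) by (simp add: free_group_def)
  have H: "subgroup H F" using assms(3) by (simp add: fin_gen_subgroup_def)
  have p: "p > 1" "p - 1 > 0" using prime_gt_1_nat[OF assms(4)] by auto
  have N: "N \<lhd> F" unfolding assms(5) by (rule F.derived_power_normal[OF F.normal_self])
  interpret N: normal N F by fact
  interpret FN: group "F\<lparr>carrier := N\<rparr>" by (rule F.subgroup_imp_group[OF N.subgroup_axioms])
  define M where "M = derived_power F N p"
  have M: "M \<lhd> F" unfolding M_def by (rule F.derived_power_normal[OF N])
  interpret M: normal M F by fact
  have MN: "M \<subseteq> N" unfolding M_def by (rule F.derived_power_subset[OF N.subgroup_axioms])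
  have M_eq: "derived_power (F\<lparr>carrier := N\<rparr>) N p = M"
    unfolding M_def by (rule F.derived_power_consistent[OF N.subgroup_axioms])
  have finN: "finite (rcosets\<^bsub>F\<^esub> N)"
    unfolding assms(5) by (rule F.finite_rcosets_derived_power[OF assms(2) p(2)])
  have "fin_gen_subgroup (carrier (F\<lparr>carrier := N\<rparr>)) (F\<lparr>carrier := N\<rparr>)"
    using F.fin_gen_subgroup_finite_index[OF assms(2) N.subgroup_axioms finN] by simp
  then have finMN: "finite (rcosets\<^bsub>F\<lparr>carrier := N\<rparr>\<^esub> M)"
    using FN.finite_rcosets_derived_power[of p] p M_eq by simp
  have finM: "finite (rcosets\<^bsub>F\<^esub> M)"
    by (rule F.finite_rcosets_trans[OF N.subgroup_axioms finN M.subgroup_axioms MN finMN])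
  have dense_AbAb: "pro_dense (class_prod (Ab p) (Ab (p - 1))) F H \<longleftrightarrow> H <#>\<^bsub>F\<^esub> M = carrier F"
  proof (rule F.pro_dense_iff_set_mult[OF H M finM])
    fix K assume "K \<lhd> F"
    then show "class_prod (Ab p) (Ab (p - 1)) (F Mod K) \<longleftrightarrow> finite (rcosets\<^bsub>F\<^esub> K) \<and> M \<subseteq> K"
      unfolding M_def assms(5) by (rule normal.class_prod_Ab_Ab_Mod_iff)
  qed
  have dense_Ab: "pro_dense (Ab (p - 1)) F H \<longleftrightarrow> H <#>\<^bsub>F\<^esub> N = carrier F"
  proof (rule F.pro_dense_iff_set_mult[OF H N finN])
    fix K assume "K \<lhd> F"
    then show "Ab (p - 1) (F Mod K) \<longleftrightarrow> finite (rcosets\<^bsub>F\<^esub> K) \<and> N \<subseteq> K"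
      unfolding assms(5) by (rule normal.Ab_Mod_iff)
  qed
  have HN: "subgroup (H \<inter> N) (F\<lparr>carrier := N\<rparr>)"
    by (intro F.subgroup_incl F.subgroups_Inter_pair H N.subgroup_axioms) simp
  have MN_normal: "M \<lhd> F\<lparr>carrier := N\<rparr>"
    by (rule F.normal_restrict_supergroup[OF N.subgroup_axioms M MN])
  have "pro_dense (Ab p) (F\<lparr>carrier := N\<rparr>) (H \<inter> N) \<longleftrightarrow>
    (H \<inter> N) <#>\<^bsub>F\<lparr>carrier := N\<rparr>\<^esub> M = carrier (F\<lparr>carrier := N\<rparr>)"
  proof (rule FN.pro_dense_iff_set_mult[OF HN MN_normal finMN])
    fix K assume "K \<lhd> F\<lparr>carrier := N\<rparr>"
    then show "Ab p (F\<lparr>carrier := N\<rparr> Mod K) \<longleftrightarrow>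
        finite (rcosets\<^bsub>F\<lparr>carrier := N\<rparr>\<^esub> K) \<and> M \<subseteq> K"
      using normal.Ab_Mod_iff[of K "F\<lparr>carrier := N\<rparr>" p] M_eq by simp
  qed
  then have dense_Ab_N: "pro_dense (Ab p) (F\<lparr>carrier := N\<rparr>) (H \<inter> N) \<longleftrightarrow> (H \<inter> N) <#>\<^bsub>F\<^esub> M = N"
    by simp
  have dense_H: "pro_dense (H_groups p) F H \<longleftrightarrow>
    (\<forall>K. K \<lhd> F \<and> finite (rcosets\<^bsub>F\<^esub> K) \<and> (\<forall>x\<in>N. \<exists>k. x [^]\<^bsub>F\<^esub> (p ^ k) \<in> K) \<longrightarrow>
      H <#>\<^bsub>F\<^esub> K = carrier F)"
    by (rule F.pro_dense_H_groups_iff[OF H assms(4), folded assms(5)])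
  have "H <#>\<^bsub>F\<^esub> M = carrier F" if "pro_dense (H_groups p) F H"
  proof -
    have "\<forall>x\<in>N. \<exists>k. x [^]\<^bsub>F\<^esub> (p ^ k) \<in> M"
      using F.derived_power_subset_iff[OF N.subset M.subgroup_axioms, of p] unfolding M_def
      by (metis order_refl power_one_right)
    then show ?thesis using that M finM unfolding dense_H by blast
  qed
  moreover have "pro_dense (H_groups p) F H" if "H <#>\<^bsub>F\<^esub> M = carrier F"
    unfolding dense_H
    using F.set_mult_eq_carrier_of_p_power_mod[OF assms(4) H N.subgroup_axioms] that
    unfolding M_def by blast
  moreover have "H <#>\<^bsub>F\<^esub> N = carrier F" if "H <#>\<^bsub>F\<^esub> M = carrier F"
    by (rule F.set_mult_eq_carrierI[OF H that N.subset])
      (use MN subgroup.one_closed[OF H] in \<open>force simp: set_mult_def\<close>)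
  moreover have "(H \<inter> N) <#>\<^bsub>F\<^esub> M = N" if "H <#>\<^bsub>F\<^esub> M = carrier F"
    by (rule F.set_mult_Int_eq[OF H N.subgroup_axioms MN that])
  moreover have "H <#>\<^bsub>F\<^esub> M = carrier F"
    if "H <#>\<^bsub>F\<^esub> N = carrier F" "(H \<inter> N) <#>\<^bsub>F\<^esub> M = N"
    by (rule F.set_mult_eq_carrierI[OF H that(1) M.subset])
      (use that(2) mono_set_mult[of "H \<inter> N" H M M F] in blast)
  ultimately show ?thesis
    unfolding dense_AbAb dense_Ab dense_Ab_N M_def[symmetric] by blast
qed

end
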